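(* Let $n\ge1$ and $Q:=\mathbb{R}^n\times(0,\infty)$. There exists a constant $c>0$, depending only on $n$, such that for every $\varepsilon\in(0,1)$, every $(x_0,t_0)\in Q$ such that $B_1(x_0,t_0)\subset Q$, every weak solution $u_\varepsilon$ to $$-\varepsilon\partial_{tt}u_\varepsilon+\partial_t u_\varepsilon-\Delta u_\varepsilon=-\chi_{\{u_\varepsilon>0\}}\quad\text{in }B_1(x_0,t_0),$$ every $(z_\varepsilon,\tau_\varepsilon)\in\overline{\{u_\varepsilon>0\}}\cap B_{1/2}(x_0,t_0)$, and every $r\in(0,\tfrac12)$, we have $$\sup_{B_r(z_\varepsilon,\tau_\varepsilon)}u_\varepsilon\ge cr^2.$$
   Context: $B_r(x_0,t_0)$ denotes the open Euclidean ball in $\mathbb{R}^{n+1}$ of radius $r$ centered at $(x_0,t_0)\in\mathbb{R}^n\times\mathbb{R}$. $\Delta$ is the Laplacian in the $x$ variables. A weak solution in $B_1(x_0,t_0)$ is a function $u\in H^1(B_1(x_0,t_0))$ (in the variables $(x,t)$) with $\int(\varepsilon\partial_t u\,\partial_t\eta+\partial_t u\,\eta+\nabla u\cdot\nabla\eta+\chi_{\{u>0\}}\eta)\,dx\,dt=0$ for all $\eta\in C_c^\infty(B_1(x_0,t_0))$; by interior elliptic regularity it is continuous in $B_1(x_0,t_0)$, and $u$ is identified with its continuous representative, so that $\{u>0\}$ is open. *)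

theory Defs
  imports "HOL-Analysis.Analysis"
begin

primrec C_diff :: "nat \<Rightarrow> ('a::euclidean_space \<Rightarrow> real) \<Rightarrow> bool" where
  "C_diff 0 f \<longleftrightarrow> continuous_on UNIV f"
| "C_diff (Suc k) f \<longleftrightarrow>
     f differentiable_on UNIV \<and> (\<forall>i\<in>Basis. C_diff k (\<lambda>x. frechet_derivative f (at x) i))"

definition test_functions :: "'a::euclidean_space set \<Rightarrow> ('a \<Rightarrow> real) set" where
  "test_functions U =
     {\<eta>. (\<forall>k. C_diff k \<eta>) \<and> compact (closure {x. \<eta> x \<noteq> 0}) \<and> closure {x. \<eta> x \<noteq> 0} \<subseteq> U}"

definition grad :: "('a::euclidean_space \<Rightarrow> real) \<Rightarrow> 'a \<Rightarrow> 'a" where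
  "grad f x = (\<Sum>i\<in>Basis. frechet_derivative f (at x) i *\<^sub>R i)"

definition L2 :: "'a::euclidean_space set \<Rightarrow> ('a \<Rightarrow> 'b::euclidean_space) set" where
  "L2 U = {f. set_borel_measurable lebesgue U f \<and>
              set_integrable lebesgue U (\<lambda>x. (norm (f x))\<^sup>2)}"

(* Only meaningful for locally integrable u and G; below it is used for u, G in L2 U. *)
definition has_weak_gradient ::
    "'a::euclidean_space set \<Rightarrow> ('a \<Rightarrow> real) \<Rightarrow> ('a \<Rightarrow> 'a) \<Rightarrow> bool" where
  "has_weak_gradient U u G \<longleftrightarrow>
     (\<forall>\<phi>\<in>test_functions U. \<forall>i\<in>Basis.
        (LINT x:U|lebesgue. u x * (grad \<phi> x \<bullet> i)) = - (LINT x:U|lebesgue. (G x \<bullet> i) * \<phi> x))"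

definition H1 :: "'a::euclidean_space set \<Rightarrow> ('a \<Rightarrow> real) set" where
  "H1 U = {u \<in> L2 U. \<exists>G\<in>L2 U. has_weak_gradient U u G}"

(* For open U the weak gradient is unique up to null sets, so the choice is immaterial. *)
definition weak_grad :: "'a::euclidean_space set \<Rightarrow> ('a \<Rightarrow> real) \<Rightarrow> 'a \<Rightarrow> 'a" where
  "weak_grad U u = (SOME G. G \<in> L2 U \<and> has_weak_gradient U u G)"

(* Weak solutions of  - eps * u_tt + u_t - Laplace_x u = - indicator {u > 0}  in U.
   Gradients are space-time gradients: fst is the gradient in x, snd the derivative in t. *)
definition weak_solution ::
    "real \<Rightarrow> ((real ^ 'n) \<times> real) set \<Rightarrow> ((real ^ 'n) \<times> real \<Rightarrow> real) \<Rightarrow> bool" where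
  "weak_solution \<epsilon> U u \<longleftrightarrow>
     u \<in> H1 U \<and>
     (\<forall>\<eta>\<in>test_functions U.
        (LINT p:U|lebesgue.
             \<epsilon> * snd (weak_grad U u p) * snd (grad \<eta> p)
           + snd (weak_grad U u p) * \<eta> p
           + fst (weak_grad U u p) \<bullet> fst (grad \<eta> p)
           + indicator {q \<in> U. u q > 0} p * \<eta> p) = 0)"

end

theory Submission imports Defs begin

text \<open>
  Let \<open>u p > 0\<close>. On the set where \<open>u > 0\<close> the function
  \<open>u q - c * (dist q p)\<^sup>2\<close> is a strict subsolution as soon as \<open>2 * c * (n + 2) < 1\<close>, so it has no
  interior maximum there. If \<open>u < c * \<rho>\<^sup>2\<close> held on \<open>cball p \<rho>\<close>, its maximum over the part of
  that ball where \<open>u \<ge> u p / 2\<close> would be interior. As \<open>u\<close> is only a continuous distributional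
  solution, the maximum is taken for the mollification \<open>W\<close> of \<open>u\<close> instead, which is uniformly
  close to \<open>u\<close>: the second derivative test for \<open>W\<close> in the coordinate directions at the maximum
  contradicts the equation tested with the mollifying kernel.
\<close>

section \<open>Smooth flat functions and a bump built from them\<close>

text \<open>For positive arguments this is \<open>exp (- 1 / s) / s ^ m\<close>. The index
  \<open>m\<close> makes the family closed under differentiation up to linear combinations, so one
  derivative formula covers all orders.\<close>

definition flat :: "nat \<Rightarrow> real \<Rightarrow> real" where
  "flat m s = (if s > 0 then exp (- inverse s) * inverse s ^ m else 0)"

text \<open>A single term of the exponential series at \<open>x = 1 / s\<close> bounds
  \<open>x ^ (m + 2)\<close> by \<open>fact (m + 2) * exp x\<close>. Taking the index two above
  \<open>m\<close> leaves a spare factor \<open>s\<^sup>2\<close>, which forces the derivative at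
  the origin to be zero.\<close>

lemma flat_quadratic_bound: "\<bar>flat m s\<bar> \<le> fact (m + 2) * s\<^sup>2"
proof (cases "s > 0")
  case True
  define x where "x = inverse s"
  have x: "x > 0" using True by (simp add: x_def)
  have "(\<lambda>n. x ^ n / fact n) sums exp x"
    using exp_converges[of x] by (simp add: divide_inverse mult.commute)
  then have "(\<Sum>n\<in>{m + 2}. x ^ n / fact n) \<le> exp x"
    using x sum_le_suminf[of "\<lambda>n. x ^ n / fact n" "{m + 2}"] by (simp add: sums_iff)
  then have "x ^ (m + 2) / fact (m + 2) \<le> exp x" by simp
  then have "exp (- x) * x ^ (m + 2) \<le> fact (m + 2)"
    by (simp add: exp_minus divide_simps mult.commute del: fact_Suc power_Suc add_2_eq_Suc')
  then have "exp (- x) * x ^ (m + 2) * s\<^sup>2 \<le> fact (m + 2) * s\<^sup>2"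
    by (intro mult_right_mono) auto
  moreover have "exp (- x) * x ^ (m+2) * s\<^sup>2 = flat m s"
    using True by (simp add: flat_def x_def power_add field_simps power2_eq_square)
  moreover have "flat m s \<ge> 0" using True by (simp add: flat_def)
  ultimately show ?thesis by simp
qed (auto simp: flat_def)

lemma flat_has_field_derivative:
  "(flat m has_field_derivative flat (m + 2) s - real m * flat (m + 1) s) (at s)"
proof -
  consider "s > 0" | "s < 0" | "s = 0" by linarith
  then show ?thesis
  proof cases
    case 1
    have inv: "(inverse has_field_derivative - (inverse s * inverse s)) (at s)"
      using DERIV_inverse[of s] 1 by (simp add: power2_eq_square)
    have "((\<lambda>s. exp (- inverse s) * inverse s ^ m) has_field_derivative
        exp (- inverse s) * - (- (inverse s * inverse s)) * inverse s ^ m +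
        of_nat m * - (inverse s * inverse s) * inverse s ^ (m - Suc 0) * exp (- inverse s)) (at s)"
      using DERIV_mult[OF DERIV_chain2[OF DERIV_exp DERIV_minus[OF inv]] DERIV_power[OF inv, of m]]
      by (simp add: mult_ac)
    moreover have "exp (- inverse s) * - (- (inverse s * inverse s)) * inverse s ^ m +
        of_nat m * - (inverse s * inverse s) * inverse s ^ (m - Suc 0) * exp (- inverse s) =
        flat (m + 2) s - real m * flat (m + 1) s"
      using 1 by (cases m) (simp_all add: flat_def algebra_simps)
    ultimately have "((\<lambda>s. exp (- inverse s) * inverse s ^ m) has_field_derivative
        flat (m + 2) s - real m * flat (m + 1) s) (at s)" by simp
    then show ?thesis
      by (rule has_field_derivative_transform_within_open[where S="{0<..}"])
         (use 1 in \<open>auto simp: flat_def\<close>)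
  next
    case 2
    have "((\<lambda>s. 0) has_field_derivative flat (m + 2) s - real m * flat (m + 1) s) (at s)"
      using 2 by (auto simp: flat_def)
    then show ?thesis
      by (rule has_field_derivative_transform_within_open[where S="{..<0}"])
         (use 2 in \<open>auto simp: flat_def\<close>)
  next
    case 3
    \<comment> \<open>As \<open>flat m 0 = 0\<close>, this is the difference quotient at the origin;
      the quadratic bound makes it at most a constant times \<open>\<bar>h\<bar>\<close>.\<close>
    have "((\<lambda>h. flat m h / h) \<longlongrightarrow> 0) (at 0)"
    proof (rule Lim_null_comparison)
      have "norm (flat m h / h) \<le> fact (m + 2) * \<bar>h\<bar>" if "h \<noteq> 0" for h
        using that flat_quadratic_bound[of m h] power2_abs[of h]
        by (simp add: divide_simps power2_eq_square mult.assoc del: fact_Suc add_2_eq_Suc')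
      then show "\<forall>\<^sub>F h in at 0. norm (flat m h / h) \<le> fact (m + 2) * \<bar>h\<bar>"
        by (simp add: eventually_at_filter del: fact_Suc add_2_eq_Suc')
      show "((\<lambda>h. fact (m + 2) * \<bar>h\<bar>) \<longlongrightarrow> (0::real)) (at 0)"
        by (auto intro!: tendsto_eq_intros)
    qed
    then show ?thesis using 3 by (simp add: has_field_derivative_iff flat_def)
  qed
qed

text \<open>A class containing the bump and closed under directional derivatives, so that all orders
  of \<open>C_diff\<close> follow by one induction. The linear functions are included because the
  chain rule applied to \<open>r - p \<bullet> p\<close> produces a factor
  \<open>x \<bullet> d\<close>.\<close>

inductive_set bump_algebra :: "real \<Rightarrow> ('a::euclidean_space \<Rightarrow> real) set" for r where
  const: "(\<lambda>_. c) \<in> bump_algebra r"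
| linear: "(\<lambda>p. p \<bullet> a) \<in> bump_algebra r"
| flat: "(\<lambda>p. flat m (r - p \<bullet> p)) \<in> bump_algebra r"
| add: "f \<in> bump_algebra r \<Longrightarrow> g \<in> bump_algebra r \<Longrightarrow> (\<lambda>p. f p + g p) \<in> bump_algebra r"
| mult: "f \<in> bump_algebra r \<Longrightarrow> g \<in> bump_algebra r \<Longrightarrow> (\<lambda>p. f p * g p) \<in> bump_algebra r"

lemma bump_algebra_has_derivative:
  assumes "f \<in> bump_algebra r"
  shows "\<exists>F. (\<forall>x. (f has_derivative F x) (at x)) \<and> (\<forall>d. (\<lambda>x. F x d) \<in> bump_algebra r)"
  using assms
proof induction
  case (const c)
  show ?case
    by (rule exI[of _ "\<lambda>_ _. 0"]) (auto intro: bump_algebra.const)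
next
  case (linear a)
  show ?case
    by (rule exI[of _ "\<lambda>_ d. d \<bullet> a"])
       (auto intro!: bump_algebra.const derivative_eq_intros)
next
  case (flat m)
  define F where "F = (\<lambda>x d :: 'a. (flat (m + 2) (r - x \<bullet> x) + (- real m) * flat (m + 1) (r - x \<bullet> x)) * ((-2) * (x \<bullet> d)))"
  have "((\<lambda>p. flat m (r - p \<bullet> p)) has_derivative F x) (at x)" for x
  proof -
    have "((\<lambda>p. r - p \<bullet> p) has_derivative (\<lambda>d. (-2) * (x \<bullet> d))) (at x)"
      by (auto intro!: derivative_eq_intros simp: inner_commute)
    from has_derivative_compose[OF this flat_has_field_derivative[unfolded has_field_derivative_def]]
    show ?thesis by (simp add: F_def)
  qed
  moreover have "(\<lambda>x. F x d) \<in> bump_algebra r" for d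
    unfolding F_def by (intro bump_algebra.intros)
  ultimately show ?case by blast
next
  case (add f g)
  then obtain F G where FG: "\<And>x. (f has_derivative F x) (at x)" "\<And>x. (g has_derivative G x) (at x)"
    "\<And>d. (\<lambda>x. F x d) \<in> bump_algebra r" "\<And>d. (\<lambda>x. G x d) \<in> bump_algebra r" by metis
  show ?case
    by (rule exI[of _ "\<lambda>x d. F x d + G x d"])
       (auto intro!: bump_algebra.add derivative_eq_intros FG)
next
  case (mult f g)
  then obtain F G where FG: "\<And>x. (f has_derivative F x) (at x)" "\<And>x. (g has_derivative G x) (at x)"
    "\<And>d. (\<lambda>x. F x d) \<in> bump_algebra r" "\<And>d. (\<lambda>x. G x d) \<in> bump_algebra r" by metis
  show ?case
    by (rule exI[of _ "\<lambda>x d. f x * G x d + F x d * g x"])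
       (auto intro!: bump_algebra.add bump_algebra.mult derivative_eq_intros FG mult)
qed

lemma C_diff_bump_algebra: "f \<in> bump_algebra r \<Longrightarrow> C_diff k f"
proof (induction k arbitrary: f)
  case 0
  from bump_algebra_has_derivative[OF this] show ?case
    by (metis C_diff.simps(1) continuous_at_imp_continuous_on has_derivative_continuous)
next
  case (Suc k)
  from bump_algebra_has_derivative[OF Suc.prems] obtain F where
    F: "\<And>x. (f has_derivative F x) (at x)" "\<And>d. (\<lambda>x. F x d) \<in> bump_algebra r" by blast
  have "frechet_derivative f (at x) = F x" for x
    using F(1) frechet_derivative_at by metis
  then show ?case using F Suc.IH
    by (auto simp: differentiable_on_def differentiable_def intro: has_derivative_at_withinI)
qed

section \<open>Derivatives, bounds and translates of test functions\<close>

abbreviation pd :: "'a::euclidean_space \<Rightarrow> ('a \<Rightarrow> real) \<Rightarrow> 'a \<Rightarrow> real" where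
  "pd i f \<equiv> \<lambda>x. frechet_derivative f (at x) i"

lemma grad_inner_Basis: "i \<in> Basis \<Longrightarrow> grad f x \<bullet> i = pd i f x"
  by (simp add: grad_def inner_sum_left inner_Basis if_distrib sum.delta cong: if_cong)

lemma test_functions_has_derivative:
  assumes "\<eta> \<in> test_functions U"
  shows "(\<eta> has_derivative frechet_derivative \<eta> (at x)) (at x)"
proof -
  have "C_diff (Suc 0) \<eta>" using assms by (auto simp: test_functions_def)
  then show ?thesis
    by (simp add: differentiable_on_def frechet_derivative_works)
qed

text \<open>Off the closed support the function vanishes on a neighbourhood, so its derivative
  vanishes there too and differentiation does not enlarge the support.\<close>

lemma test_functions_pd:
  assumes "\<eta> \<in> test_functions U" "i \<in> Basis"
  shows "pd i \<eta> \<in> test_functions U"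
proof -
  have C: "C_diff k (pd i \<eta>)" for k
    using assms unfolding test_functions_def by (metis (mono_tags, lifting) C_diff.simps(2) mem_Collect_eq)
  have "pd i \<eta> x = 0" if "x \<notin> closure {x. \<eta> x \<noteq> 0}" for x
  proof -
    have eq: "0 = \<eta> y" if "y \<in> - closure {x. \<eta> x \<noteq> 0}" for y
      using that closure_subset[of "{x. \<eta> x \<noteq> 0}"] by auto
    have "(\<eta> has_derivative (\<lambda>_. 0)) (at x)"
      by (rule has_derivative_transform_within_open[where s="- closure {x. \<eta> x \<noteq> 0}",
            OF has_derivative_const _ _ eq]) (use that in auto)
    from fun_cong[OF frechet_derivative_at[OF this], of i] show ?thesis by simp
  qed
  then have sub: "closure {x. pd i \<eta> x \<noteq> 0} \<subseteq> closure {x. \<eta> x \<noteq> 0}"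
    by (intro closure_minimal) auto
  moreover from sub have "compact (closure {x. pd i \<eta> x \<noteq> 0})"
    using closed_Int_compact[OF closed_closure, of "closure {x. \<eta> x \<noteq> 0}" "{x. pd i \<eta> x \<noteq> 0}"] assms
    by (simp add: Int_absorb2 test_functions_def)
  ultimately show ?thesis using C assms
    unfolding test_functions_def by blast
qed

lemma test_functions_continuous: "\<eta> \<in> test_functions U \<Longrightarrow> continuous_on S \<eta>"
  by (auto simp: test_functions_def intro: continuous_on_subset[of UNIV] dest!: spec[of _ 0])

lemma test_functions_bounded:
  assumes "\<eta> \<in> test_functions U"
  obtains B where "\<And>x. \<bar>\<eta> x\<bar> \<le> B"
proof -
  have "compact (\<eta> ` closure {x. \<eta> x \<noteq> 0})"
    using assms test_functions_continuous[OF assms] by (intro compact_continuous_image) (auto simp: test_functions_def)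
  then obtain B where B: "B > 0" "\<And>x. x \<in> closure {x. \<eta> x \<noteq> 0} \<Longrightarrow> \<bar>\<eta> x\<bar> \<le> B"
    using bounded_pos[THEN iffD1, OF compact_imp_bounded] by (metis imageI real_norm_def)
  have "\<bar>\<eta> x\<bar> \<le> B" for x
    using B closure_subset[of "{x. \<eta> x \<noteq> 0}"] by (cases "\<eta> x = 0") auto
  with that show ?thesis by blast
qed

text \<open>This localises a kernel known only as a test function on the whole space: the bound
  \<open>d\<close> on its support keeps the translate inside \<open>cball a d\<close>.\<close>

lemma test_functions_translate:
  assumes "\<eta> \<in> test_functions UNIV" "\<And>x. \<eta> x \<noteq> 0 \<Longrightarrow> norm x \<le> d" "cball a d \<subseteq> U"
  shows "(\<lambda>x. \<eta> (x - a)) \<in> test_functions U"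
proof -
  have C: "C_diff k (\<lambda>x. f (x - a))" if "C_diff k f" for k f
    using that
  proof (induction k arbitrary: f)
    case 0
    then show ?case by (auto intro!: continuous_intros intro: continuous_on_compose2[of UNIV f])
  next
    case (Suc k)
    have "((\<lambda>x. f (x - a)) has_derivative frechet_derivative f (at (x - a))) (at x)" for x
    proof -
      have "(f has_derivative frechet_derivative f (at (x - a))) (at (x - a))"
        using Suc.prems by (simp add: differentiable_on_def frechet_derivative_works)
      then show ?thesis
        by (rule has_derivative_compose[rotated, where f="\<lambda>x. x - a" and f'="\<lambda>x. x"])
           (auto intro!: derivative_eq_intros)
    qed
    moreover from this have "frechet_derivative (\<lambda>x. f (x - a)) (at x) = frechet_derivative f (at (x - a))" for x
      by (metis frechet_derivative_at)
    moreover have "C_diff k (\<lambda>x. frechet_derivative f (at (x - a)) i)" if "i \<in> Basis" for i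
      using Suc.IH[of "pd i f"] Suc.prems that by simp
    ultimately show ?case
      by (auto simp: differentiable_on_def differentiable_def intro: has_derivative_at_withinI)
  qed
  have "closure {x. \<eta> (x - a) \<noteq> 0} \<subseteq> cball a d"
    by (intro closure_minimal) (auto simp: dist_norm norm_minus_commute dest: assms(2))
  moreover from this have "compact (closure {x. \<eta> (x - a) \<noteq> 0})"
    by (meson bounded_cball bounded_subset closed_closure compact_eq_bounded_closed)
  ultimately show ?thesis using assms C by (auto simp: test_functions_def)
qed

lemma pd_translate:
  assumes "\<eta> \<in> test_functions U"
  shows "pd i (\<lambda>x. \<eta> (x - a)) = (\<lambda>x. pd i \<eta> (x - a))"
proof
  fix x
  have "((\<lambda>x. \<eta> (x - a)) has_derivative frechet_derivative \<eta> (at (x - a))) (at x)"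
    by (rule has_derivative_compose[OF _ test_functions_has_derivative[OF assms], where f="\<lambda>x. x - a" and f'="\<lambda>x. x"])
       (auto intro!: derivative_eq_intros)
  then show "pd i (\<lambda>x. \<eta> (x - a)) x = pd i \<eta> (x - a)" by (metis frechet_derivative_at)
qed

section \<open>Mollification and differentiation under the integral\<close>

lemma continuous_imp_lebesgue_measurable:
  fixes g :: "'a::euclidean_space \<Rightarrow> 'b::euclidean_space"
  assumes "continuous_on UNIV g"
  shows "g \<in> borel_measurable lebesgue"
  using borel_measurable_continuous_onI[OF assms] by (simp add: measurable_completion)

lemma integrable_mult_bounded_continuous:
  fixes v g :: "'a::euclidean_space \<Rightarrow> real"
  assumes "integrable lebesgue v" "continuous_on UNIV g" "\<And>x. \<bar>g x\<bar> \<le> B"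
  shows "integrable lebesgue (\<lambda>p. v p * g p)"
proof (rule Bochner_Integration.integrable_bound)
  show "integrable lebesgue (\<lambda>p. B * v p)" using assms(1) by simp
  show "(\<lambda>p. v p * g p) \<in> borel_measurable lebesgue"
    using assms(1) continuous_imp_lebesgue_measurable[OF assms(2)] by (intro borel_measurable_times) auto
  have "\<bar>v p\<bar> * \<bar>g p\<bar> \<le> \<bar>B\<bar> * \<bar>v p\<bar>" for p
    using mult_left_mono[OF order_trans[OF assms(3) abs_ge_self], of "\<bar>v p\<bar>" p] by (simp add: mult.commute)
  then show "AE p in lebesgue. norm (v p * g p) \<le> norm (B * v p)"
    by (simp add: abs_mult)
qed

lemma integrable_mult_test_function:
  assumes "integrable lebesgue v" "\<eta> \<in> test_functions U"
  shows "integrable lebesgue (\<lambda>p. v p * \<eta> p)"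
  using test_functions_bounded[OF assms(2)]
  by (metis integrable_mult_bounded_continuous[OF assms(1)] test_functions_continuous[OF assms(2)])

lemma continuous_on_translate:
  fixes f :: "'a::real_normed_vector \<Rightarrow> 'b::topological_space"
  shows "continuous_on UNIV f \<Longrightarrow> continuous_on UNIV (\<lambda>x. f (x - a))"
  by (rule continuous_on_compose2[of UNIV f]) (auto intro!: continuous_intros)

text \<open>Dominated convergence along sequences, with a multiple of \<open>\<bar>v p\<bar>\<close>
  as majorant because \<phi> is bounded.\<close>

lemma continuous_on_mollification:
  fixes v \<phi> :: "'a::euclidean_space \<Rightarrow> real"
  assumes v: "integrable lebesgue v" and \<phi>: "\<phi> \<in> test_functions U"
  shows "continuous_on S (\<lambda>y. LINT p|lebesgue. v p * \<phi> (p - y))"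
proof -
  note cont = test_functions_continuous[OF \<phi>, of UNIV]
  obtain B where B: "\<And>x. \<bar>\<phi> x\<bar> \<le> B" using test_functions_bounded[OF \<phi>] by blast
  have "(\<lambda>n. LINT p|lebesgue. v p * \<phi> (p - X n)) \<longlonglongrightarrow> (LINT p|lebesgue. v p * \<phi> (p - y))"
    if X: "X \<longlonglongrightarrow> y" for X y
  proof (rule integral_dominated_convergence)
    show "integrable lebesgue (\<lambda>p. \<bar>v p\<bar> * B)" using v by simp
    show "(\<lambda>p. v p * \<phi> (p - y)) \<in> borel_measurable lebesgue" for y
      using integrable_mult_bounded_continuous[OF v continuous_on_translate[OF cont] B] by blast
    then show "(\<lambda>p. v p * \<phi> (p - X n)) \<in> borel_measurable lebesgue" for n .
    have "(\<lambda>n. \<phi> (p - X n)) \<longlonglongrightarrow> \<phi> (p - y)" for p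
      using cont by (intro continuous_on_tendsto_compose[OF cont] tendsto_intros X) auto
    then show "AE p in lebesgue. (\<lambda>n. v p * \<phi> (p - X n)) \<longlonglongrightarrow> v p * \<phi> (p - y)"
      by (intro always_eventually allI tendsto_intros)
    show "AE p in lebesgue. norm (v p * \<phi> (p - X n)) \<le> \<bar>v p\<bar> * B" for n
      using B by (auto simp: abs_mult intro!: mult_left_mono)
  qed
  then show ?thesis
    by (intro continuous_at_imp_continuous_on) (auto simp: continuous_at_sequentially comp_def)
qed

lemma test_functions_directional_derivative:
  assumes "\<phi> \<in> test_functions U"
  shows "((\<lambda>h. \<phi> (q - h *\<^sub>R e)) has_field_derivative - pd e \<phi> (q - h *\<^sub>R e)) (at h)"
proof -
  let ?D = "frechet_derivative \<phi> (at (q - h *\<^sub>R e))"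
  have "((\<lambda>h. q - h *\<^sub>R e) has_derivative (\<lambda>d. - (d *\<^sub>R e))) (at h)"
    by (auto intro!: derivative_eq_intros)
  from has_derivative_compose[OF this test_functions_has_derivative[OF assms]]
  have D: "((\<lambda>h. \<phi> (q - h *\<^sub>R e)) has_derivative (\<lambda>d. ?D (- (d *\<^sub>R e)))) (at h)" .
  have "linear ?D"
    using test_functions_has_derivative[OF assms] by (rule has_derivative_linear)
  then have "(\<lambda>d. ?D (- (d *\<^sub>R e))) = (*) (- ?D e)"
    by (simp add: fun_eq_iff linear_neg linear_cmul)
  with D show ?thesis by (simp only: has_field_derivative_def)
qed

text \<open>Difference quotients along arbitrary null sequences converge by dominated convergence;
  the mean value inequality bounds those of the kernel by \<open>B'\<close>, uniformly in the
  sequence. The minus sign arises because the centre enters as \<open>p - y\<close>. Since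
  \<open>pd e \<phi>\<close> is again a test function, the lemma can be applied twice.\<close>

lemma mollification_directional_derivative:
  fixes v \<phi> :: "'a::euclidean_space \<Rightarrow> real"
  assumes v: "integrable lebesgue v" and \<phi>: "\<phi> \<in> test_functions U" and e: "e \<in> Basis"
  shows "((\<lambda>h. LINT p|lebesgue. v p * \<phi> (p - (y + h *\<^sub>R e))) has_field_derivative
           - (LINT p|lebesgue. v p * pd e \<phi> (p - (y + h *\<^sub>R e)))) (at h)"
proof -
  have \<phi>': "pd e \<phi> \<in> test_functions U" using test_functions_pd[OF \<phi> e] .
  note cont = continuous_on_translate[OF test_functions_continuous[OF \<phi>, of UNIV]]
  note cont' = continuous_on_translate[OF test_functions_continuous[OF \<phi>', of UNIV]]
  obtain B where B: "\<And>x. \<bar>\<phi> x\<bar> \<le> B" using test_functions_bounded[OF \<phi>] by blast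
  obtain B' where B': "\<And>x. \<bar>pd e \<phi> x\<bar> \<le> B'" using test_functions_bounded[OF \<phi>'] by blast
  define f where "f = (\<lambda>p h. \<phi> (p - (y + h *\<^sub>R e)))"
  have f: "(f p has_field_derivative - pd e \<phi> (p - (y + h *\<^sub>R e))) (at h)" for p h
    using test_functions_directional_derivative[OF \<phi>, of "p - y" e h] by (simp add: f_def algebra_simps)
  have int: "integrable lebesgue (\<lambda>p. v p * f p h)" for h
    unfolding f_def by (rule integrable_mult_bounded_continuous[OF v cont B])
  have int': "integrable lebesgue (\<lambda>p. v p * - pd e \<phi> (p - (y + h *\<^sub>R e)))"
    using integrable_mult_bounded_continuous[OF v cont' B'] by simp
  have "(\<lambda>n. ((LINT p|lebesgue. v p * f p (h + k n)) - (LINT p|lebesgue. v p * f p h)) / k n)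
      \<longlonglongrightarrow> (LINT p|lebesgue. v p * - pd e \<phi> (p - (y + h *\<^sub>R e)))"
    if k: "k \<longlonglongrightarrow> 0" "\<And>n. k n \<noteq> 0" for k :: "nat \<Rightarrow> real"
  proof -
    have "(\<lambda>n. LINT p|lebesgue. (v p * f p (h + k n) - v p * f p h) / k n)
      \<longlonglongrightarrow> (LINT p|lebesgue. v p * - pd e \<phi> (p - (y + h *\<^sub>R e)))"
    proof (rule integral_dominated_convergence)
      show "integrable lebesgue (\<lambda>p. \<bar>v p\<bar> * B')" using v by simp
      show "(\<lambda>p. v p * - pd e \<phi> (p - (y + h *\<^sub>R e))) \<in> borel_measurable lebesgue"
        using int' by blast
      have "integrable lebesgue (\<lambda>p. (v p * f p (h + k n) - v p * f p h) / k n)" for n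
        using int by simp
      then show "(\<lambda>p. (v p * f p (h + k n) - v p * f p h) / k n) \<in> borel_measurable lebesgue" for n
        by blast
      have "(\<lambda>n. (f p (h + k n) - f p h) / k n) \<longlonglongrightarrow> - pd e \<phi> (p - (y + h *\<^sub>R e))" for p
        using f[of p h] k unfolding DERIV_def tendsto_at_iff_sequentially by (auto simp: comp_def)
      then have "(\<lambda>n. v p * ((f p (h + k n) - f p h) / k n)) \<longlonglongrightarrow> v p * - pd e \<phi> (p - (y + h *\<^sub>R e))" for p
        by (intro tendsto_intros)
      then show "AE p in lebesgue. (\<lambda>n. (v p * f p (h + k n) - v p * f p h) / k n)
          \<longlonglongrightarrow> v p * - pd e \<phi> (p - (y + h *\<^sub>R e))"
        by (simp add: algebra_simps)
      have "\<bar>f p (h + k n) - f p h\<bar> \<le> B' * \<bar>k n\<bar>" for p n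
        using field_differentiable_bound[of UNIV "f p" "\<lambda>s. - pd e \<phi> (p - (y + s *\<^sub>R e))" B' "h + k n" h] f B'
        by simp
      then have "\<bar>v p\<bar> * (\<bar>f p (h + k n) - f p h\<bar> / \<bar>k n\<bar>) \<le> \<bar>v p\<bar> * B'" for p n
        using k(2)[of n] by (intro mult_left_mono) (auto simp: divide_simps)
      then show "AE p in lebesgue. norm ((v p * f p (h + k n) - v p * f p h) / k n) \<le> \<bar>v p\<bar> * B'" for n
        by (simp add: abs_mult flip: right_diff_distrib)
    qed
    then show ?thesis using int by simp
  qed
  then have "((\<lambda>h. LINT p|lebesgue. v p * f p h) has_field_derivative
      (LINT p|lebesgue. v p * - pd e \<phi> (p - (y + h *\<^sub>R e)))) (at h)"
    unfolding DERIV_def tendsto_at_iff_sequentially by (auto simp: comp_def)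
  then show ?thesis unfolding f_def by simp
qed

text \<open>If \<open>l\<close> were positive, \<open>g'\<close> would be positive just to the right
  of its zero \<open>a\<close>, and the mean value theorem would make \<open>g\<close> exceed
  \<open>g a\<close> there.\<close>

lemma second_derivative_test:
  fixes g g' :: "real \<Rightarrow> real"
  assumes g: "\<And>h. (g has_field_derivative g' h) (at h)" and g': "(g' has_field_derivative l) (at a)"
    and max: "s > 0" "\<And>h. \<bar>h - a\<bar> < s \<Longrightarrow> g h \<le> g a"
  shows "g' a = 0" "l \<le> 0"
proof -
  show 0: "g' a = 0"
    using DERIV_local_max[OF g max(1)] max(2) by (metis abs_minus_commute)
  show "l \<le> 0"
  proof (rule ccontr)
    assume "\<not> l \<le> 0"
    then obtain d where d: "d > 0" "\<And>h. 0 < h \<Longrightarrow> h < d \<Longrightarrow> g' a < g' (a + h)"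
      using DERIV_pos_inc_right[OF g'] by auto
    define h where "h = min d s / 2"
    have h: "0 < h" "h < d" "h < s" using d(1) max(1) by (auto simp: h_def)
    obtain z where z: "a < z" "z < a + h" "g (a + h) - g a = (a + h - a) * g' z"
      using MVT2[of a "a + h" g g'] g h by auto
    have "g' z > 0" using d(2)[of "z - a"] z h 0 by simp
    then have "g (a + h) > g a" using z h by (simp add: algebra_simps zero_less_mult_iff)
    then show False using max(2)[of "a + h"] h by simp
  qed
qed

text \<open>For Borel functions the integral over the completed measure equals that over
  \<open>lborel\<close>, which is translation invariant. This makes the mass of the kernel
  independent of its centre.\<close>

lemma lebesgue_integral_translate:
  fixes g :: "'a::euclidean_space \<Rightarrow> real"
  assumes "continuous_on UNIV g"
  shows "(LINT p|lebesgue. g (p - y)) = (LINT p|lebesgue. g p)"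
proof -
  have g: "g \<in> borel_measurable borel" using borel_measurable_continuous_onI[OF assms] .
  have gy: "(\<lambda>p. g (p - y)) \<in> borel_measurable borel"
    using borel_measurable_continuous_onI[OF continuous_on_translate[OF assms]] .
  have "(LINT p|lborel. g p) = (LINT p|distr lborel borel ((+) (- y)). g p)"
    by (simp add: lborel_distr_plus)
  also have "\<dots> = (LINT p|lborel. g (- y + p))"
    using g by (intro integral_distr) auto
  finally show ?thesis using g gy by (simp add: integral_completion)
qed

section \<open>The equation in distributional form\<close>

text \<open>On a set of finite measure \<open>1 + x\<^sup>2\<close> is an integrable majorant of
  \<open>x\<close>.\<close>

lemma L2_imp_integrable:
  assumes "f \<in> L2 U" "U \<in> lmeasurable"
  shows "integrable lebesgue (\<lambda>p. indicator U p *\<^sub>R f p)"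
proof (rule Bochner_Integration.integrable_bound)
  show "integrable lebesgue (\<lambda>p. indicator U p + indicator U p *\<^sub>R (norm (f p))\<^sup>2)"
    using assms by (intro Bochner_Integration.integrable_add)
      (auto simp: L2_def set_integrable_def fmeasurable_def)
  show "(\<lambda>p. indicator U p *\<^sub>R f p) \<in> borel_measurable lebesgue"
    using assms by (simp add: L2_def set_borel_measurable_def)
  have "x \<le> 1 + x\<^sup>2" for x :: real
    using sum_squares_ge_zero[of "x - 1" "x"] by (simp add: power2_eq_square algebra_simps)
  then show "AE p in lebesgue. norm (indicator U p *\<^sub>R f p) \<le>
      norm (indicator U p + indicator U p *\<^sub>R (norm (f p))\<^sup>2 :: real)"
    by (auto simp: indicator_def)
qed

text \<open>The definition of the weak gradient moves every derivative onto \<eta>, each time with a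
  minus sign, which takes the three terms to the other side of the indicator term. Writing the
  factor \<open>indicator U p\<close> instead of a set integral matches the extension of
  \<open>u\<close> by zero that is mollified later.\<close>

lemma distributional_equation:
  fixes U :: "((real ^ 'n) \<times> real) set"
  assumes sol: "weak_solution \<epsilon> U u" and U: "open U" "U \<in> lmeasurable" "continuous_on U u"
    and \<eta>: "\<eta> \<in> test_functions U"
  shows "\<epsilon> * (LINT p|lebesgue. indicator U p * u p * pd (0, 1) (pd (0, 1) \<eta>) p)
       + (LINT p|lebesgue. indicator U p * u p * pd (0, 1) \<eta> p)
       + (\<Sum>i\<in>Basis. LINT p|lebesgue. indicator U p * u p * pd (i, 0) (pd (i, 0) \<eta>) p)
       = (LINT p|lebesgue. indicator {q \<in> U. u q > 0} p * \<eta> p)"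
proof -
  define G where "G = weak_grad U u"
  have "G \<in> L2 U \<and> has_weak_gradient U u G"
    using sol unfolding G_def weak_grad_def weak_solution_def H1_def
    by (intro someI_ex[of "\<lambda>G. G \<in> L2 U \<and> has_weak_gradient U u G"]) auto
  then have G: "G \<in> L2 U" "has_weak_gradient U u G" by auto
  have g: "integrable lebesgue (\<lambda>p. indicator U p * (G p \<bullet> i))" for i
  proof -
    have "integrable lebesgue (\<lambda>p. (indicator U p *\<^sub>R G p) \<bullet> i)"
      using L2_imp_integrable[OF G(1) U(2)] by (intro integrable_inner_left) auto
    then show ?thesis by simp
  qed
  have t: "(0, 1) \<in> (Basis :: ((real ^ 'n) \<times> real) set)"
    and x: "\<And>i. i \<in> Basis \<Longrightarrow> (i, 0) \<in> (Basis :: ((real ^ 'n) \<times> real) set)"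
    by (auto simp: Basis_prod_def)
  have parts: "(LINT p|lebesgue. indicator U p * u p * pd i \<psi> p) =
      - (LINT p|lebesgue. indicator U p * (G p \<bullet> i) * \<psi> p)"
    if "\<psi> \<in> test_functions U" "i \<in> Basis" for \<psi> i
    using G(2) that unfolding has_weak_gradient_def set_lebesgue_integral_def
    by (simp add: grad_inner_Basis mult.assoc)
  have pos: "open {q \<in> U. u q > 0}"
  proof -
    have "{q \<in> U. u q > 0} = U \<inter> u -` {0<..}" by auto
    then show ?thesis using continuous_open_preimage[OF U(3,1), of "{0<..}"] by simp
  qed
  have \<chi>: "integrable lebesgue (indicator {q \<in> U. u q > 0} :: _ \<Rightarrow> real)"
    by (intro integrable_real_indicator)
       (use pos fmeasurableI2[OF U(2), of "{q \<in> U. u q > 0}"] in \<open>auto simp: fmeasurable_def\<close>)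
  let ?Gt = "\<lambda>p. indicator U p * (G p \<bullet> (0, 1))" and ?Gx = "\<lambda>i p. indicator U p * (G p \<bullet> (i, 0))"
  have "0 = (LINT p|lebesgue. indicator U p *\<^sub>R (\<epsilon> * snd (G p) * snd (grad \<eta> p)
           + snd (G p) * \<eta> p + fst (G p) \<bullet> fst (grad \<eta> p)
           + indicator {q \<in> U. u q > 0} p * \<eta> p))"
    using sol \<eta> unfolding weak_solution_def set_lebesgue_integral_def G_def by simp
  also have "\<dots> = (LINT p|lebesgue. \<epsilon> * (?Gt p * pd (0, 1) \<eta> p) + ?Gt p * \<eta> p
           + (\<Sum>i\<in>Basis. ?Gx i p * pd (i, 0) \<eta> p)
           + indicator {q \<in> U. u q > 0} p * \<eta> p)"
  proof (rule Bochner_Integration.integral_cong[OF refl])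
    fix p
    have "snd y = y \<bullet> (0, 1)" for y :: "(real^'n) \<times> real" by (simp add: inner_prod_def)
    then have gt: "snd (grad \<eta> p) = pd (0, 1) \<eta> p" "snd (G p) = G p \<bullet> (0, 1)"
      using grad_inner_Basis[OF t] by auto
    have "fst (G p) \<bullet> fst (grad \<eta> p) = (\<Sum>i\<in>Basis. (G p \<bullet> (i, 0)) * (grad \<eta> p \<bullet> (i, 0)))"
      by (subst euclidean_inner) (simp add: inner_prod_def)
    also have "\<dots> = (\<Sum>i\<in>Basis. (G p \<bullet> (i, 0)) * pd (i, 0) \<eta> p)"
      by (intro sum.cong refl) (simp add: grad_inner_Basis x)
    finally show "indicator U p *\<^sub>R (\<epsilon> * snd (G p) * snd (grad \<eta> p)
           + snd (G p) * \<eta> p + fst (G p) \<bullet> fst (grad \<eta> p)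
           + indicator {q \<in> U. u q > 0} p * \<eta> p) =
        \<epsilon> * (?Gt p * pd (0, 1) \<eta> p) + ?Gt p * \<eta> p
           + (\<Sum>i\<in>Basis. ?Gx i p * pd (i, 0) \<eta> p)
           + indicator {q \<in> U. u q > 0} p * \<eta> p"
      unfolding gt by (simp add: indicator_def)
  qed
  also have "\<dots> = \<epsilon> * (LINT p|lebesgue. ?Gt p * pd (0, 1) \<eta> p) + (LINT p|lebesgue. ?Gt p * \<eta> p)
           + (\<Sum>i\<in>Basis. LINT p|lebesgue. ?Gx i p * pd (i, 0) \<eta> p)
           + (LINT p|lebesgue. indicator {q \<in> U. u q > 0} p * \<eta> p)"
  proof -
    note I = integrable_mult_test_function[OF g]
    have 1: "integrable lebesgue (\<lambda>p. \<epsilon> * (?Gt p * pd (0, 1) \<eta> p))"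
      using I[OF test_functions_pd[OF \<eta> t]] by simp
    have 2: "integrable lebesgue (\<lambda>p. ?Gt p * \<eta> p)" using I[OF \<eta>] .
    have 3: "integrable lebesgue (\<lambda>p. ?Gx i p * pd (i, 0) \<eta> p)" if "i \<in> Basis" for i
      using I[OF test_functions_pd[OF \<eta> x[OF that]]] .
    have 4: "integrable lebesgue (\<lambda>p. indicator {q \<in> U. u q > 0} p * \<eta> p)"
      using integrable_mult_test_function[OF \<chi> \<eta>] .
    have 5: "integrable lebesgue (\<lambda>p. \<Sum>i\<in>Basis. ?Gx i p * pd (i, 0) \<eta> p)"
      by (rule Bochner_Integration.integrable_sum) (rule 3)
    have 6: "(LINT p|lebesgue. (\<Sum>i\<in>Basis. ?Gx i p * pd (i, 0) \<eta> p)) =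
        (\<Sum>i\<in>Basis. LINT p|lebesgue. ?Gx i p * pd (i, 0) \<eta> p)"
      by (rule Bochner_Integration.integral_sum) (rule 3)
    note 12 = Bochner_Integration.integrable_add[OF 1 2]
    note 125 = Bochner_Integration.integrable_add[OF 12 5]
    show ?thesis
      by (simp only: Bochner_Integration.integral_add[OF 125 4] Bochner_Integration.integral_add[OF 12 5]
          Bochner_Integration.integral_add[OF 1 2] integral_mult_right_zero 6)
  qed
  \<comment> \<open>The second-order terms use \<open>parts\<close> with a derivative of \<eta> as
    test function, the drift term uses it with \<eta> itself.\<close>
  finally show ?thesis
    using parts[OF \<eta> t] parts[OF test_functions_pd[OF \<eta> t] t]
    by (simp add: parts[OF test_functions_pd[OF \<eta> x] x] sum_negf)
qed

section \<open>The mollifying kernel\<close>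

lemma bump_test_function: "(\<lambda>p. flat 0 (\<delta>\<^sup>2 - p \<bullet> p)) \<in> test_functions UNIV"
proof -
  \<comment> \<open>No sign of \<delta> is assumed, hence the absolute value in the radius.\<close>
  have "closure {p :: 'a. flat 0 (\<delta>\<^sup>2 - p \<bullet> p) \<noteq> 0} \<subseteq> cball 0 \<bar>\<delta>\<bar>"
  proof (intro closure_minimal subsetI closed_cball)
    fix p :: 'a
    assume "p \<in> {p. flat 0 (\<delta>\<^sup>2 - p \<bullet> p) \<noteq> 0}"
    then have "(norm p)\<^sup>2 \<le> \<delta>\<^sup>2" by (simp add: flat_def power2_norm_eq_inner split: if_splits)
    then show "p \<in> cball 0 \<bar>\<delta>\<bar>" by (simp flip: abs_le_square_iff)
  qed
  then have "compact (closure {p :: 'a. flat 0 (\<delta>\<^sup>2 - p \<bullet> p) \<noteq> 0})"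
    by (meson bounded_cball bounded_subset closed_closure compact_eq_bounded_closed)
  then show ?thesis
    using C_diff_bump_algebra[OF bump_algebra.flat] by (auto simp: test_functions_def)
qed

text \<open>A nonnegative function with zero integral vanishes almost everywhere, but this one is
  positive on a ball of positive measure.\<close>

lemma integral_bump_pos:
  assumes "\<delta> > 0"
  shows "(LINT p|lebesgue. flat 0 (\<delta>\<^sup>2 - (p :: 'a::euclidean_space) \<bullet> p)) > 0"
proof -
  let ?\<phi> = "\<lambda>p :: 'a. flat 0 (\<delta>\<^sup>2 - p \<bullet> p)"
  have ball: "ball 0 \<delta> \<in> lmeasurable" by simp
  have pos: "?\<phi> p > 0 \<longleftrightarrow> p \<in> ball 0 \<delta>" for p
    using assms by (simp add: flat_def norm_lt_square flip: power2_norm_eq_inner)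
  have nn: "?\<phi> p \<ge> 0" for p by (simp add: flat_def)
  \<comment> \<open>Multiplying by the indicator of the ball changes nothing, and turns the bump
    into an integrable function times a bounded continuous one.\<close>
  have "integrable lebesgue (\<lambda>p. indicator (ball 0 \<delta>) p * ?\<phi> p)"
    by (rule integrable_mult_test_function[OF _ bump_test_function])
       (use ball in \<open>auto simp: fmeasurable_def\<close>)
  moreover have "indicator (ball 0 \<delta>) p * ?\<phi> p = ?\<phi> p" for p
    using pos[of p] nn[of p] by (cases "p \<in> ball 0 \<delta>") auto
  ultimately have int: "integrable lebesgue ?\<phi>" by simp
  have "integral\<^sup>L lebesgue ?\<phi> \<noteq> 0"
  proof
    assume "integral\<^sup>L lebesgue ?\<phi> = 0"
    then have "AE p in lebesgue. ?\<phi> p = 0"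
      using integral_nonneg_eq_0_iff_AE[OF int] nn by simp
    then have "AE p in lebesgue. p \<notin> ball (0 :: 'a) \<delta>"
      by (rule eventually_mono) (metis less_irrefl pos)
    then have "measure lebesgue (ball (0 :: 'a) \<delta>) = 0"
      by (simp add: AE_iff_null_sets[of "ball (0 :: 'a) \<delta>"] null_setsD1 measure_def)
    then show False using content_ball_pos[OF assms, of "0 :: 'a"] by simp
  qed
  moreover have "integral\<^sup>L lebesgue ?\<phi> \<ge> 0" using nn by simp
  ultimately show ?thesis by linarith
qed

section \<open>The growth estimate at a point of positivity\<close>

text \<open>The gap between \<rho> and \<open>R\<close> is room for the mollifying kernel. The bound
  \<open>\<rho> \<le> 1\<close> controls the drift of the paraboloid, and
  \<open>\<epsilon> < 1\<close> its second time derivative, so the constant depends on the dimension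
  alone.\<close>

lemma quadratic_growth_on_ball:
  fixes U :: "((real ^ 'n) \<times> real) set"
  assumes sol: "weak_solution \<epsilon> U u" and U: "open U" "U \<in> lmeasurable" "continuous_on U u"
    and \<epsilon>: "0 < \<epsilon>" "\<epsilon> < 1"
    and p: "cball p R \<subseteq> U" "u p > 0" and \<rho>: "0 < \<rho>" "\<rho> < R" "\<rho> \<le> 1"
  shows "\<exists>q\<in>cball p \<rho>. \<rho>\<^sup>2 / (2 * (real CARD('n) + 3)) \<le> u q"
proof (rule ccontr)
  \<comment> \<open>Chosen so that \<open>2 * c * (n + 3) = 1\<close>, strictly more than the
    \<open>2 * c * (n + 2)\<close> which the \<open>n\<close> space directions, the second time
    derivative and the drift can contribute.\<close>
  define c where "c = 1 / (2 * (real CARD('n) + 3))"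
  have c: "c > 0" by (simp add: c_def)
  assume "\<not> ?thesis"
  then have small: "u q < c * \<rho>\<^sup>2" if "q \<in> cball p \<rho>" for q
    using that by (auto simp: c_def not_le)
  define a where "a = u p"
  have a: "a > 0" using p by (simp add: a_def)
  have contR: "continuous_on (cball p R) u" using U(3) p(1) by (rule continuous_on_subset)
  \<comment> \<open>The tolerance \<open>a / 8\<close> is spent twice, on the mollification error at
    \<open>p\<close> and at the maximum point; this leaves \<open>3 / 4 * a\<close>, still above the
    level \<open>a / 2\<close> cutting out \<open>K\<close>.\<close>
  obtain d where d: "d > 0" "\<And>x y. x \<in> cball p R \<Longrightarrow> y \<in> cball p R \<Longrightarrow> dist y x < d \<Longrightarrow> dist (u y) (u x) < a / 8"
    using compact_uniformly_continuous[OF contR compact_cball] a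
    unfolding uniformly_continuous_on_def by (metis divide_pos_pos zero_less_numeral)
  \<comment> \<open>The first entry keeps the oscillation of \<open>u\<close> below
    \<open>a / 8\<close> on the kernel's support, the second keeps that support inside
    \<open>cball p R\<close>.\<close>
  define \<delta> where "\<delta> = min (d / 2) (R - \<rho>)"
  have \<delta>: "\<delta> > 0" "\<delta> < d" "\<delta> \<le> R - \<rho>" using d \<rho> by (auto simp: \<delta>_def)
  have near: "q \<in> U" "\<bar>u q - u y\<bar> < a / 8"
    if "y \<in> cball p \<rho>" "dist y q \<le> \<delta>" for y q
  proof -
    have q: "q \<in> cball p R" using that \<delta>(3) dist_triangle[of p q y] by simp
    then show "q \<in> U" using p(1) by blast
    have "y \<in> cball p R" using that(1) \<rho> by simp
    then show "\<bar>u q - u y\<bar> < a / 8"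
      using d(2)[OF _ q, of y] that(2) \<delta>(2) by (simp add: dist_real_def dist_commute)
  qed

  define \<phi> where "\<phi> = (\<lambda>q :: (real^'n) \<times> real. flat 0 (\<delta>\<^sup>2 - q \<bullet> q))"
  have \<phi>: "\<phi> \<in> test_functions UNIV" unfolding \<phi>_def by (rule bump_test_function)
  have \<phi>_nonneg: "\<phi> q \<ge> 0" for q by (simp add: \<phi>_def flat_def)
  have \<phi>_supp: "norm q \<le> \<delta>" if "\<phi> q \<noteq> 0" for q
  proof -
    have "(norm q)\<^sup>2 \<le> \<delta>\<^sup>2" using that by (simp add: \<phi>_def flat_def power2_norm_eq_inner split: if_splits)
    then show ?thesis using \<delta>(1) by (simp flip: abs_le_square_iff)
  qed
  have \<phi>_cont: "continuous_on UNIV (\<lambda>q. \<phi> (q - y))" for y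
    by (intro continuous_on_translate test_functions_continuous[OF \<phi>])
  define Z where "Z = (LINT q|lebesgue. \<phi> q)"
  have Z: "Z > 0" unfolding Z_def \<phi>_def by (rule integral_bump_pos[OF \<delta>(1)])
  have Z_translate: "(LINT q|lebesgue. \<phi> (q - y)) = Z" for y
    unfolding Z_def by (rule lebesgue_integral_translate[OF test_functions_continuous[OF \<phi>]])
  \<comment> \<open>The Bochner integral of a non-integrable function is zero by convention, so the
    nonzero value \<open>Z\<close> already implies integrability.\<close>
  have \<phi>_int: "integrable lebesgue (\<lambda>q. \<phi> (q - y))" for y
    using Z_translate[of y] Z not_integrable_integral_eq by fastforce

  \<comment> \<open>Extension by zero gives a function integrable on the whole space; it agrees with
    \<open>u\<close> on the support of every kernel centred in
    \<open>cball p \<rho>\<close>.\<close>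
  define v where "v = (\<lambda>q. indicator U q * u q)"
  have v: "integrable lebesgue v"
    using L2_imp_integrable[of u U] sol U(2) by (simp add: v_def weak_solution_def H1_def)
  have v_\<phi>: "integrable lebesgue (\<lambda>q. v q * \<phi> (q - y))" for y
    using test_functions_bounded[OF \<phi>]
    by (metis integrable_mult_bounded_continuous[OF v \<phi>_cont])
  define W where "W = (\<lambda>y. (LINT q|lebesgue. v q * \<phi> (q - y)) / Z)"
  have W_cont: "continuous_on S W" for S
    unfolding W_def using Z by (intro continuous_intros continuous_on_mollification[OF v \<phi>]) auto
  \<comment> \<open>Since the kernel has mass \<open>Z\<close>, the error is an average of
    \<open>v q - u y\<close> over points \<open>q\<close> within \<delta> of
    \<open>y\<close>.\<close>
  have W_approx: "\<bar>W y - u y\<bar> \<le> a / 8" if y: "y \<in> cball p \<rho>" for y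
  proof -
    have "\<bar>(LINT q|lebesgue. v q * \<phi> (q - y)) - u y * Z\<bar> =
        \<bar>LINT q|lebesgue. v q * \<phi> (q - y) - u y * \<phi> (q - y)\<bar>"
      using v_\<phi> \<phi>_int by (simp add: Z_translate)
    also have "\<dots> \<le> (LINT q|lebesgue. a / 8 * \<phi> (q - y))"
    proof (rule order_trans[OF integral_abs_bound integral_mono])
      show "integrable lebesgue (\<lambda>q. \<bar>v q * \<phi> (q - y) - u y * \<phi> (q - y)\<bar>)"
        using v_\<phi> \<phi>_int by simp
      show "integrable lebesgue (\<lambda>q. a / 8 * \<phi> (q - y))" using \<phi>_int by simp
      show "\<bar>v q * \<phi> (q - y) - u y * \<phi> (q - y)\<bar> \<le> a / 8 * \<phi> (q - y)" for q
      proof (cases "\<phi> (q - y) = 0")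
        case False
        then have "dist y q \<le> \<delta>" using \<phi>_supp by (metis dist_commute dist_norm)
        with near[OF y] have "\<bar>v q - u y\<bar> \<le> a / 8" by (simp add: v_def less_imp_le)
        then have "\<bar>v q - u y\<bar> * \<phi> (q - y) \<le> a / 8 * \<phi> (q - y)"
          using \<phi>_nonneg by (intro mult_right_mono)
        then show ?thesis using \<phi>_nonneg by (simp add: abs_mult flip: left_diff_distrib)
      qed simp
    qed
    also have "\<dots> = a / 8 * Z" by (simp add: Z_translate)
    finally have "\<bar>W y * Z - u y * Z\<bar> \<le> a / 8 * Z" using Z by (simp add: W_def)
    then have "\<bar>W y - u y\<bar> * Z \<le> a / 8 * Z" using Z by (simp add: abs_mult flip: left_diff_distrib)
    then show ?thesis using Z by simp
  qed

  define F where "F = (\<lambda>y. W y - c * ((y - p) \<bullet> (y - p)))"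
  define K where "K = {y \<in> cball p \<rho>. a / 2 \<le> u y}"
  have cont\<rho>: "continuous_on (cball p \<rho>) u"
    using contR by (rule continuous_on_subset) (use \<rho> in auto)
  have "K = cball p \<rho> \<inter> u -` {a / 2..}" by (auto simp: K_def)
  then have "closed K" using continuous_closed_preimage[OF cont\<rho>] by simp
  then have "compact K"
    unfolding compact_eq_bounded_closed by (auto simp: K_def intro: bounded_subset[OF bounded_cball[of p \<rho>]])
  moreover have pK: "p \<in> K" using a \<rho> by (simp add: K_def a_def)
  moreover have "continuous_on K F" unfolding F_def by (intro continuous_intros W_cont)
  ultimately obtain y0 where y0: "y0 \<in> K" "\<And>y. y \<in> K \<Longrightarrow> F y \<le> F y0"
    using continuous_attains_sup[of K F] by blast
  have y0\<rho>: "y0 \<in> cball p \<rho>" using y0(1) by (simp add: K_def)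
  have "\<bar>W p - a\<bar> \<le> a / 8" using W_approx[of p] \<rho> by (simp flip: a_def)
  then have "W p \<ge> 7 / 8 * a" by linarith
  then have "F y0 \<ge> 7 / 8 * a" using y0(2)[OF pK] by (simp add: F_def)
  then have large: "u y0 - c * (dist y0 p)\<^sup>2 \<ge> 3 / 4 * a"
    using W_approx[OF y0\<rho>] unfolding F_def dist_norm power2_norm_eq_inner by linarith
  \<comment> \<open>On the sphere the contradiction hypothesis gives
    \<open>u y0 < c * \<rho>\<^sup>2\<close>, against the positive lower bound in
    \<open>large\<close>. The other part of the boundary of \<open>K\<close>, where \<open>u\<close>
    equals \<open>a / 2\<close>, is excluded by the same bound below.\<close>
  have "dist y0 p \<noteq> \<rho>"
    using large small[OF y0\<rho>] a by auto
  then have 1: "y0 \<in> ball p \<rho>" using y0\<rho> by (simp add: dist_commute)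
  have "0 \<le> c * (dist y0 p)\<^sup>2" using c by simp
  then have 2: "u y0 > a / 2" using large a by linarith
  have "open (ball p \<rho> \<inter> u -` {a / 2<..})"
    by (rule continuous_open_preimage[OF continuous_on_subset[OF cont\<rho> ball_subset_cball]]) auto
  moreover have "y0 \<in> ball p \<rho> \<inter> u -` {a / 2<..}" using 1 2 by simp
  ultimately obtain s where s: "s > 0" "ball y0 s \<subseteq> ball p \<rho> \<inter> u -` {a / 2<..}"
    by (meson open_contains_ball)
  have max: "F y \<le> F y0" if "dist y0 y < s" for y
  proof -
    have "y \<in> ball p \<rho> \<inter> u -` {a / 2<..}" using s(2) that by (meson mem_ball subsetD)
    then show ?thesis using y0(2)[of y] by (simp add: K_def)
  qed

  define I1 where "I1 = (\<lambda>e. LINT q|lebesgue. v q * pd e \<phi> (q - y0))"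
  define I2 where "I2 = (\<lambda>e. LINT q|lebesgue. v q * pd e (pd e \<phi>) (q - y0))"
  \<comment> \<open>Along a coordinate line through \<open>y0\<close>, the first and second
    derivatives of \<open>W\<close> are \<open>- I1 e / Z\<close> and \<open>I2 e / Z\<close>, while
    the paraboloid has second derivative \<open>2 * c\<close>. Coordinate directions suffice because
    the equation has no mixed derivatives.\<close>
  have test: "I1 e = - (2 * c * Z * ((y0 - p) \<bullet> e))" "I2 e \<le> 2 * c * Z" if e: "e \<in> Basis" for e
  proof -
    define g where "g = (\<lambda>h. F (y0 + h *\<^sub>R e))"
    define g' where "g' = (\<lambda>h. - (LINT q|lebesgue. v q * pd e \<phi> (q - (y0 + h *\<^sub>R e))) / Z
        - c * (2 * ((y0 - p) \<bullet> e) + 2 * h))"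
    have g_eq: "g = (\<lambda>h. (LINT q|lebesgue. v q * \<phi> (q - (y0 + h *\<^sub>R e))) / Z
        - c * ((y0 - p) \<bullet> (y0 - p) + 2 * h * ((y0 - p) \<bullet> e) + h\<^sup>2))"
    proof
      fix h
      have "y0 + h *\<^sub>R e - p = (y0 - p) + h *\<^sub>R e" by simp
      then have "(y0 + h *\<^sub>R e - p) \<bullet> (y0 + h *\<^sub>R e - p) =
          (y0 - p) \<bullet> (y0 - p) + 2 * h * ((y0 - p) \<bullet> e) + h\<^sup>2"
        using e by (simp only: inner_add_left inner_add_right inner_scaleR_left inner_scaleR_right inner_same_Basis)
          (simp add: inner_commute power2_eq_square distrib_left)
      then show "g h = (LINT q|lebesgue. v q * \<phi> (q - (y0 + h *\<^sub>R e))) / Z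
        - c * ((y0 - p) \<bullet> (y0 - p) + 2 * h * ((y0 - p) \<bullet> e) + h\<^sup>2)"
        by (simp add: g_def F_def W_def)
    qed
    have D: "(g has_field_derivative g' h) (at h)" for h
      unfolding g_eq g'_def
      by (intro DERIV_diff DERIV_cdivide mollification_directional_derivative[OF v \<phi> e])
         (auto intro!: derivative_eq_intros simp: algebra_simps)
    have D': "(g' has_field_derivative (I2 e / Z - 2 * c)) (at 0)"
    proof -
      have "((\<lambda>h. LINT q|lebesgue. v q * pd e \<phi> (q - (y0 + h *\<^sub>R e))) has_field_derivative - I2 e) (at 0)"
        using mollification_directional_derivative[OF v test_functions_pd[OF \<phi> e] e, of y0 0]
        by (simp add: I2_def)
      moreover have "((\<lambda>h. c * (2 * ((y0 - p) \<bullet> e) + 2 * h)) has_field_derivative 2 * c) (at 0)"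
        by (auto intro!: derivative_eq_intros)
      ultimately show ?thesis
        unfolding g'_def using DERIV_diff[OF DERIV_cdivide[OF DERIV_minus]] by fastforce
    qed
    have "g h \<le> g 0" if "\<bar>h - 0\<bar> < s" for h
      using max[of "y0 + h *\<^sub>R e"] that e by (simp add: g_def dist_norm)
    from second_derivative_test[OF D D' s(1) this]
    have "- (I1 e) / Z - 2 * c * ((y0 - p) \<bullet> e) = 0" "I2 e / Z \<le> 2 * c"
      by (auto simp: g'_def I1_def)
    then show "I1 e = - (2 * c * Z * ((y0 - p) \<bullet> e))" "I2 e \<le> 2 * c * Z"
      using Z by (auto simp: field_simps)
  qed

  have "cball y0 \<delta> \<subseteq> U" using near(1)[OF y0\<rho>] by auto
  then have \<eta>: "(\<lambda>q. \<phi> (q - y0)) \<in> test_functions U"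
    using test_functions_translate[OF \<phi>] \<phi>_supp by blast
  have t: "(0, 1) \<in> (Basis :: ((real ^ 'n) \<times> real) set)"
    and x: "\<And>i. i \<in> Basis \<Longrightarrow> (i, 0) \<in> (Basis :: ((real ^ 'n) \<times> real) set)"
    by (auto simp: Basis_prod_def)
  have pd1: "pd e (\<lambda>q. \<phi> (q - y0)) q = pd e \<phi> (q - y0)" for e q
    by (rule fun_cong[OF pd_translate[OF \<phi>]])
  have pd2: "pd e (pd e (\<lambda>q. \<phi> (q - y0))) q = pd e (pd e \<phi>) (q - y0)" if "e \<in> Basis" for e q
    unfolding pd1 by (rule fun_cong[OF pd_translate[OF test_functions_pd[OF \<phi> that]]])
  have I1_eq: "I1 e = (LINT q|lebesgue. indicator U q * u q * pd e (\<lambda>q. \<phi> (q - y0)) q)" for e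
    by (simp only: I1_def v_def pd1)
  have I2_eq: "I2 e = (LINT q|lebesgue. indicator U q * u q * pd e (pd e (\<lambda>q. \<phi> (q - y0))) q)"
    if "e \<in> Basis" for e
    by (simp only: I2_def v_def pd2[OF that])
  \<comment> \<open>On the support of the translated kernel \<open>u\<close> differs from
    \<open>u y0 > a / 2\<close> by less than \<open>a / 8\<close>, so the indicator is one and the
    right-hand side is the full mass \<open>Z\<close>.\<close>
  have "(LINT q|lebesgue. indicator {q \<in> U. u q > 0} q * \<phi> (q - y0)) = (LINT q|lebesgue. \<phi> (q - y0))"
  proof (rule Bochner_Integration.integral_cong[OF refl])
    fix q
    show "indicator {q \<in> U. u q > 0} q * \<phi> (q - y0) = \<phi> (q - y0)"
    proof (cases "\<phi> (q - y0) = 0")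
      case False
      then have "dist y0 q \<le> \<delta>" using \<phi>_supp by (metis dist_commute dist_norm)
      from near(1,2)[OF y0\<rho> this] have "q \<in> U" "u q > 0" using 2 a by linarith+
      then show ?thesis by simp
    qed simp
  qed
  then have "\<epsilon> * I2 (0, 1) + I1 (0, 1) + (\<Sum>i\<in>Basis. I2 (i, 0)) = Z"
    using distributional_equation[OF sol U \<eta>]
    by (simp only: I1_eq I2_eq[OF t] Z_translate) (simp add: I2_eq x)
  moreover have "\<epsilon> * I2 (0, 1) \<le> 2 * c * Z"
  proof -
    have "\<epsilon> * I2 (0, 1) \<le> \<epsilon> * (2 * c * Z)" using \<epsilon> test(2)[OF t] by (intro mult_left_mono) auto
    also have "\<dots> \<le> 1 * (2 * c * Z)" using \<epsilon> c Z by (intro mult_right_mono) auto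
    finally show ?thesis by simp
  qed
  \<comment> \<open>The drift is fixed by the first-order condition at the maximum;
    \<open>y0\<close> lies within \<open>\<rho> \<le> 1\<close> of \<open>p\<close>.\<close>
  moreover have "I1 (0, 1) \<le> 2 * c * Z"
  proof -
    have "\<bar>(y0 - p) \<bullet> (0, 1)\<bar> \<le> norm (y0 - p)" by (rule Basis_le_norm[OF t])
    also have "\<dots> \<le> 1" using y0\<rho> \<rho>(3) by (simp add: dist_norm norm_minus_commute)
    finally have "- ((y0 - p) \<bullet> (0, 1)) \<le> 1" by linarith
    then have "2 * c * Z * - ((y0 - p) \<bullet> (0, 1)) \<le> 2 * c * Z * 1"
      using c Z by (intro mult_left_mono) auto
    then show ?thesis unfolding test(1)[OF t] by (simp only: mult_minus_right mult_1_right)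
  qed
  moreover have "(\<Sum>i\<in>(Basis :: (real^'n) set). I2 (i, 0)) \<le> real CARD('n) * (2 * c * Z)"
    using sum_bounded_above[of "Basis :: (real^'n) set" "\<lambda>i. I2 (i, 0)" "2 * c * Z"] test(2)[OF x]
    by simp
  ultimately have "Z \<le> 2 * c * Z * (real CARD('n) + 2)" by (simp add: algebra_simps)
  moreover have "2 * c * Z * (real CARD('n) + 3) = Z" by (simp add: c_def field_simps)
  moreover have "2 * c * Z * (real CARD('n) + 2) < 2 * c * Z * (real CARD('n) + 3)"
    using c Z by (intro mult_strict_left_mono) auto
  ultimately show False by linarith
qed

section \<open>From points of positivity to their closure\<close>

theorem lemma3p2:
  "\<exists>c>0. \<forall>\<epsilon> (x0 :: real ^ 'n) (t0 :: real) (u :: (real ^ 'n) \<times> real \<Rightarrow> real) z \<tau> r.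
     0 < \<epsilon> \<longrightarrow> \<epsilon> < 1 \<longrightarrow>
     (x0, t0) \<in> UNIV \<times> {0<..} \<longrightarrow>
     ball (x0, t0) 1 \<subseteq> UNIV \<times> {0<..} \<longrightarrow>
     weak_solution \<epsilon> (ball (x0, t0) 1) u \<longrightarrow>
     continuous_on (ball (x0, t0) 1) u \<longrightarrow>
     (z, \<tau>) \<in> closure {p \<in> ball (x0, t0) 1. u p > 0} \<inter> ball (x0, t0) (1/2) \<longrightarrow>
     0 < r \<longrightarrow> r < 1/2 \<longrightarrow>
     (SUP p \<in> ball (z, \<tau>) r. u p) \<ge> c * r\<^sup>2"
proof (intro exI[of _ "1 / (2 * (real CARD('n) + 3))"] conjI allI impI)
  fix \<epsilon> t0 \<tau> r :: real and x0 z :: "real ^ 'n" and u :: "(real ^ 'n) \<times> real \<Rightarrow> real"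
  define U where "U = ball (x0, t0) 1"
  define P where "P = (z, \<tau>)"
  assume \<epsilon>: "0 < \<epsilon>" "\<epsilon> < 1" and "weak_solution \<epsilon> (ball (x0, t0) 1) u"
    and "continuous_on (ball (x0, t0) 1) u"
    and "(z, \<tau>) \<in> closure {p \<in> ball (x0, t0) 1. u p > 0} \<inter> ball (x0, t0) (1/2)"
    and r: "0 < r" "r < 1/2"
  then have sol: "weak_solution \<epsilon> U u" and cont: "continuous_on U u"
    and P: "P \<in> closure {p \<in> U. u p > 0}" "P \<in> ball (x0, t0) (1/2)"
    by (auto simp: U_def P_def)
  have U: "open U" "U \<in> lmeasurable" by (auto simp: U_def)
  have cball: "cball P r \<subseteq> U"
  proof
    fix q assume "q \<in> cball P r"
    then show "q \<in> U" using P(2) r dist_triangle[of "(x0, t0)" q P] by (simp add: U_def)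
  qed
  define M where "M = (SUP p \<in> ball P r. u p)"
  define c where "c = 1 / (2 * (real CARD('n) + 3))"
  \<comment> \<open>A real supremum dominates its family only if the latter is bounded above; this
    comes from the closed ball, which still lies in \<open>U\<close>.\<close>
  have "compact (u ` cball P r)"
    by (intro compact_continuous_image continuous_on_subset[OF cont cball] compact_cball)
  then have "bdd_above (u ` ball P r)"
    by (meson ball_subset_cball bdd_above_mono bounded_imp_bdd_above compact_imp_bounded image_mono)
  then have upper: "u q \<le> M" if "q \<in> ball P r" for q
    unfolding M_def using that by (rule cSUP_upper2) auto
  have grow: "c * \<rho>\<^sup>2 \<le> M" if \<rho>: "0 < \<rho>" "\<rho> < r" for \<rho>
  proof -
    \<comment> \<open>With \<open>p\<close> closer than \<open>(r - \<rho>) / 2\<close> to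
      \<open>P\<close>, the ball of radius \<open>(r + \<rho>) / 2\<close> about \<open>p\<close>
      stays within \<open>cball P r\<close>. Its radius exceeds \<rho>, as the growth estimate
      requires.\<close>
    obtain p where p: "u p > 0" "dist p P < (r - \<rho>) / 2"
      using closure_approachable[THEN iffD1, OF P(1)] \<rho>(2)
      by (metis (no_types, lifting) diff_gt_0_iff_gt half_gt_zero mem_Collect_eq)
    have sub: "q \<in> cball P r" if "dist p q \<le> (r + \<rho>) / 2" for q
      using p(2) that \<rho>(2) dist_triangle[of P q p] by (simp add: dist_commute field_simps)
    then have "cball p ((r + \<rho>) / 2) \<subseteq> U" using cball by auto
    then have "\<exists>q\<in>cball p \<rho>. \<rho>\<^sup>2 / (2 * (real CARD('n) + 3)) \<le> u q"
      by (rule quadratic_growth_on_ball[OF sol U cont \<epsilon> _ p(1) \<rho>(1)]) (use \<rho> r in auto)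
    then obtain q where q: "q \<in> cball p \<rho>" "c * \<rho>\<^sup>2 \<le> u q" by (auto simp: c_def)
    have "q \<in> ball P r"
      using p(2) q(1) \<rho>(2) dist_triangle[of P q p] by (simp add: dist_commute field_simps)
    then show ?thesis using upper[of q] q(2) by linarith
  qed
  \<comment> \<open>Letting \<rho> increase to \<open>r\<close> recovers the bound at
    \<open>r\<close> with the same constant.\<close>
  have "((\<lambda>\<rho>. c * \<rho>\<^sup>2) \<longlongrightarrow> c * r\<^sup>2) (at_left r)" by (intro tendsto_intros)
  moreover have "\<forall>\<^sub>F \<rho> in at_left r. c * \<rho>\<^sup>2 \<le> M"
    using eventually_at_left_real[OF r(1)] by eventually_elim (use grow in auto)
  ultimately have "c * r\<^sup>2 \<le> M"
    by (rule tendsto_upperbound) simp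
  then show "(SUP p \<in> ball (z, \<tau>) r. u p) \<ge> 1 / (2 * (real CARD('n) + 3)) * r\<^sup>2"
    by (simp add: M_def P_def c_def)
qed simp

end
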